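(* For every integer $n \ge 1$ and every connected $n$-vertex graph $G$, there exists a connected graph $F$ with $|V(F)| \leq 2n^2+3n+4$ such that $\mathcal{P}_H(F)\cong G$.
   Context: Graphs are finite, without loops or multiple edges. For a connected graph $F$, $d(u,v)$ denotes the distance (length of a shortest $u$-$v$-path). The harmonic centrality of a vertex $x$ of $F$ is $H_F(x)=\sum_{u\in V(F),\,u\neq x}\frac{1}{d(u,x)}$. The harmonic periphery $\mathcal{P}_H(F)$ is the subgraph of $F$ induced by the vertices of $F$ with minimum harmonic centrality. *)

theory Defs
  imports "Graph_Theory.Digraph_Isomorphism" "Graph_Theory.Shortest_Path"
begin

text \<open>
  Finite simple graphs are the symmetric digraphs of \<^locale>\<open>graph\<close>: an edge \<open>uv\<close> is the pair of
  arcs \<open>(u, v)\<close>, \<open>(v, u)\<close>, so the length of a path, counted in arcs, is its number of edges.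
\<close>

text \<open>Only meaningful when \<open>v\<close> is reachable from \<open>u\<close>.\<close>

definition graph_dist :: "('a, 'b) pre_digraph \<Rightarrow> 'a \<Rightarrow> 'a \<Rightarrow> nat" where
  "graph_dist G u v = (LEAST k. \<exists>p. pre_digraph.apath G u p v \<and> length p = k)"

definition harmonic_centrality :: "('a, 'b) pre_digraph \<Rightarrow> 'a \<Rightarrow> real" where
  "harmonic_centrality G x = (\<Sum>u \<in> verts G - {x}. 1 / real (graph_dist G u x))"

definition harmonic_periphery :: "('a, 'b) pre_digraph \<Rightarrow> ('a, 'b) pre_digraph" where
  "harmonic_periphery G =
     G \<restriction> {x \<in> verts G. \<forall>y \<in> verts G. harmonic_centrality G x \<le> harmonic_centrality G y}"

lemma (in wf_digraph) graph_dist_apath: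
  assumes "u \<rightarrow>\<^sup>* v"
  obtains p where "apath u p v" "length p = graph_dist G u v"
proof -
  obtain p where "apath u p v"
    using assms unfolding reachable_awalk by (elim exE) (rule that, rule apath_awalk_to_apath)
  then have "\<exists>p. apath u p v \<and> length p = graph_dist G u v"
    unfolding graph_dist_def by - (rule LeastI_ex, blast)
  then show ?thesis using that by blast
qed

lemma (in wf_digraph) graph_dist_le_awalk:
  assumes "awalk u p v"
  shows "graph_dist G u v \<le> length p"
  using assms
proof (induct rule: awalk_to_apath_induct)
  case (path p)
  then have "apath u p v" by (simp add: apath_def)
  then show ?case unfolding graph_dist_def by (blast intro: Least_le)
next
  case (decomp p q r s)
  have "p = q @ r @ s"
    by (rule awalk_cyc_decompE[OF decomp(2,1,3)])
  then have "length (q @ s) \<le> length p" by simp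
  with decomp(4) show ?case by (rule order_trans)
qed

text \<open>The distance agrees with the weighted distance for unit weights.\<close>

lemma (in wf_digraph) graph_dist_eq_mu:
  assumes "u \<rightarrow>\<^sup>* v"
  shows "ereal (real (graph_dist G u v)) = \<mu> (\<lambda>_. 1) u v"
proof -
  have cost: "awalk_cost (\<lambda>_. 1) p = real (length p)" for p :: "'b list"
    by (induct p) simp_all
  obtain p where p: "apath u p v" "length p = graph_dist G u v"
    using assms by (rule graph_dist_apath)
  show ?thesis
  proof (rule antisym)
    show "ereal (real (graph_dist G u v)) \<le> \<mu> (\<lambda>_. 1) u v"
      unfolding \<mu>_def by (rule INF_greatest) (simp add: cost graph_dist_le_awalk)
    show "\<mu> (\<lambda>_. 1) u v \<le> ereal (real (graph_dist G u v))"
      using min_cost_le_walk_cost[of u p v "\<lambda>_. 1"] p by (simp add: cost apath_def)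
  qed
qed

end

theory Submission
  imports Defs
begin

text \<open>
  In a graph of diameter at most two on \<open>N\<close> vertices, a vertex \<open>x\<close> of degree \<open>d\<close> has \<open>d\<close> vertices
  at distance one and the remaining \<open>N - 1 - d\<close> at distance two, so its harmonic centrality is
  \<open>(N - 1 + d) / 2\<close>. There the harmonic periphery is simply the subgraph induced by the vertices of
  minimum degree (\<open>diameter_two_harmonic_periphery\<close>).

  It therefore suffices to embed \<open>G\<close> as an induced subgraph into a graph of diameter two so that
  its vertices are exactly those of minimum degree. Take the disjoint union of \<open>G\<close> and a clique on
  \<open>n + 2\<close> vertices, and join every vertex \<open>v\<close> of \<open>G\<close> to the first \<open>n - deg v\<close> clique vertices.
  Now every vertex of \<open>G\<close> has degree exactly \<open>n\<close>, while a clique vertex has at least its \<open>n + 1\<close>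
  clique neighbours. Degrees in \<open>G\<close> are at most \<open>n - 1\<close>, so \<open>n - deg v\<close> is positive and the first
  clique vertex is adjacent to all other vertices; hence the diameter is at most two. This
  uses only \<open>2 * n + 2\<close> vertices, which is within the required bound.
\<close>

section \<open>Harmonic centrality in graphs of diameter two\<close>

lemma (in wf_digraph) graph_dist_eq_one:
  assumes "u \<rightarrow> x" "u \<noteq> x"
  shows "graph_dist G u x = 1"
proof -
  obtain a where a: "a \<in> arcs G" "tail G a = u" "head G a = x"
    using assms(1) by (auto simp: arcs_ends_conv)
  then have "awalk u [a] x"
    by (auto simp: awalk_def)
  then have le: "graph_dist G u x \<le> 1"
    using graph_dist_le_awalk[of u "[a]" x] by simp
  obtain p where p: "apath u p x" "length p = graph_dist G u x"
    by (rule graph_dist_apath[OF reachable_adjI[OF assms(1)]])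
  then have "length p \<noteq> 0"
    using assms(2) by (cases p) (auto simp: apath_def awalk_def)
  with le p(2) show ?thesis by linarith
qed

lemma (in wf_digraph) graph_dist_eq_two:
  assumes "u \<rightarrow> w" "w \<rightarrow> x" "\<not> u \<rightarrow> x" "u \<noteq> x"
  shows "graph_dist G u x = 2"
proof -
  obtain a where a: "a \<in> arcs G" "tail G a = u" "head G a = w"
    using assms(1) by (auto simp: arcs_ends_conv)
  moreover obtain b where b: "b \<in> arcs G" "tail G b = w" "head G b = x"
    using assms(2) by (auto simp: arcs_ends_conv)
  ultimately have "awalk u [a, b] x"
    by (auto simp: awalk_def)
  then have le: "graph_dist G u x \<le> 2"
    using graph_dist_le_awalk[of u "[a, b]" x] by simp
  have "u \<rightarrow>\<^sup>* x"
    using assms(1,2) by (meson reachable_adjI reachable_trans)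
  then obtain p where p: "apath u p x" "length p = graph_dist G u x"
    by (rule graph_dist_apath)
  have "length p \<noteq> 0"
    using p(1) assms(4) by (cases p) (auto simp: apath_def awalk_def)
  moreover have "length p \<noteq> 1"
  proof
    assume "length p = 1"
    then obtain c where "p = [c]"
      by (auto simp: length_Suc_conv)
    with p have "c \<in> arcs G" "tail G c = u" "head G c = x"
      by (auto simp: apath_def awalk_def)
    with assms(3) show False by (auto simp: arcs_ends_conv)
  qed
  ultimately show ?thesis using le p(2) by linarith
qed

text \<open>
  The neighbours of \<open>x\<close> contribute \<open>1\<close> each and all other vertices \<open>1 / 2\<close> each.
\<close>

lemma (in digraph) diameter_two_harmonic_centrality:
  assumes x: "x \<in> verts G"
    and diam: "\<And>u. u \<in> verts G \<Longrightarrow> u \<noteq> x \<Longrightarrow> u \<rightarrow> x \<or> (\<exists>w. u \<rightarrow> w \<and> w \<rightarrow> x)"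
  shows "harmonic_centrality G x = (real (card (verts G)) - 1 + real (card {u. u \<rightarrow> x})) / 2"
proof -
  let ?N = "{u. u \<rightarrow> x}"
  let ?M = "verts G - {x} - ?N"
  have N: "?N \<subseteq> verts G - {x}"
    using no_loops wellformed by (auto simp: arcs_ends_conv)
  have fin: "finite (verts G - {x})" by simp
  have "card (verts G - {x}) = card (verts G) - 1" "card (verts G) \<ge> 1"
    using x by (auto simp: Suc_le_eq card_gt_0_iff)
  moreover have "card ?M = card (verts G - {x}) - card ?N"
    using N fin by (intro card_Diff_subset) (auto intro: finite_subset)
  moreover have "card ?N \<le> card (verts G - {x})"
    using N fin by (rule card_mono[rotated])
  ultimately have M: "real (card ?M) = real (card (verts G)) - 1 - real (card ?N)"
    by simp
  have "harmonic_centrality G x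
      = (\<Sum>u\<in>?M. 1 / real (graph_dist G u x)) + (\<Sum>u\<in>?N. 1 / real (graph_dist G u x))"
    unfolding harmonic_centrality_def by (rule sum.subset_diff[OF N fin])
  also have "(\<Sum>u\<in>?N. 1 / real (graph_dist G u x)) = (\<Sum>u\<in>?N. 1)"
  proof (rule sum.cong)
    fix u assume "u \<in> ?N"
    then show "1 / real (graph_dist G u x) = 1"
      using N by (subst graph_dist_eq_one) auto
  qed simp
  also have "(\<Sum>u\<in>?M. 1 / real (graph_dist G u x)) = (\<Sum>u\<in>?M. 1 / 2)"
  proof (rule sum.cong)
    fix u assume u: "u \<in> ?M"
    then obtain w where "u \<rightarrow> w" "w \<rightarrow> x"
      using diam by blast
    with u have "graph_dist G u x = 2"
      by (intro graph_dist_eq_two) auto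
    then show "1 / real (graph_dist G u x) = 1 / 2" by simp
  qed simp
  finally show ?thesis
    using M by (simp add: field_simps)
qed

text \<open>
  By the formula above, harmonic centrality is a strictly increasing function of the degree.
\<close>

lemma (in digraph) diameter_two_harmonic_periphery:
  assumes diam: "\<And>u x. u \<in> verts G \<Longrightarrow> x \<in> verts G \<Longrightarrow> u \<noteq> x \<Longrightarrow>
      u \<rightarrow> x \<or> (\<exists>w. u \<rightarrow> w \<and> w \<rightarrow> x)"
  shows "harmonic_periphery G =
    G \<restriction> {x \<in> verts G. \<forall>y \<in> verts G. card {u. u \<rightarrow> x} \<le> card {u. u \<rightarrow> y}}"
proof -
  have eq: "harmonic_centrality G x = (real (card (verts G)) - 1 + real (card {u. u \<rightarrow> x})) / 2"
    if "x \<in> verts G" for x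
    using diam[OF _ that] by (rule diameter_two_harmonic_centrality[OF that])
  have "harmonic_centrality G x \<le> harmonic_centrality G y \<longleftrightarrow> card {u. u \<rightarrow> x} \<le> card {u. u \<rightarrow> y}"
    if "x \<in> verts G" "y \<in> verts G" for x y
    unfolding eq[OF that(1)] eq[OF that(2)] by simp
  then have "{x \<in> verts G. \<forall>y \<in> verts G. harmonic_centrality G x \<le> harmonic_centrality G y}
      = {x \<in> verts G. \<forall>y \<in> verts G. card {u. u \<rightarrow> x} \<le> card {u. u \<rightarrow> y}}"
    by blast
  then show ?thesis unfolding harmonic_periphery_def by simp
qed

section \<open>Graphs given by an adjacency relation\<close>

definition relation_graph :: "'a set \<Rightarrow> ('a \<Rightarrow> 'a \<Rightarrow> bool) \<Rightarrow> ('a, 'a \<times> 'a) pre_digraph" where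
  "relation_graph A r =
    \<lparr>verts = A, arcs = {(u, v). u \<in> A \<and> v \<in> A \<and> r u v}, tail = fst, head = snd\<rparr>"

lemma verts_relation_graph [simp]: "verts (relation_graph A r) = A"
  by (simp add: relation_graph_def)

lemma dominates_relation_graph:
  "u \<rightarrow>\<^bsub>relation_graph A r\<^esub> v \<longleftrightarrow> u \<in> A \<and> v \<in> A \<and> r u v"
  by (force simp: relation_graph_def arcs_ends_conv)

lemma graph_relation_graph:
  assumes "finite A" "\<And>u. \<not> r u u" "\<And>u v. r u v \<Longrightarrow> r v u"
  shows "graph (relation_graph A r)"
proof -
  have "{(u, v). u \<in> A \<and> v \<in> A \<and> r u v} \<subseteq> A \<times> A" by auto
  then have "finite {(u, v). u \<in> A \<and> v \<in> A \<and> r u v}"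
    using assms(1) by (meson finite_SigmaI finite_subset)
  moreover have "symmetric (relation_graph A r)"
    using assms(3) unfolding symmetric_def by (auto intro: symI simp: dominates_relation_graph)
  ultimately show ?thesis
    using assms(1,2)
    by unfold_locales (auto simp: relation_graph_def arc_to_ends_def)
qed

lemma induce_relation_graph:
  assumes "B \<subseteq> A"
  shows "relation_graph A r \<restriction> B = relation_graph B r"
  using assms by (auto simp: relation_graph_def induce_subgraph_def)

text \<open>
  Without parallel arcs, the action of an isomorphism on arcs is determined by its action on
  vertices: an arc must go to the unique arc joining the images of its ends.
\<close>

lemma digraph_iso_if_dominates_iff:
  assumes "nomulti_digraph G" "nomulti_digraph H"
    and bij: "bij_betw f (verts G) (verts H)"
    and adj: "\<And>u v. u \<in> verts G \<Longrightarrow> v \<in> verts G \<Longrightarrow> u \<rightarrow>\<^bsub>G\<^esub> v \<longleftrightarrow> f u \<rightarrow>\<^bsub>H\<^esub> f v"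
  shows "digraph_iso G H"
proof -
  interpret G: nomulti_digraph G by fact
  interpret H: nomulti_digraph H by fact
  define g where "g a = the_inv_into (arcs H) (arc_to_ends H) (f (tail G a), f (head G a))" for a
  have inj: "inj_on (arc_to_ends H) (arcs H)"
    by (rule inj_onI) (rule H.no_multi_arcs)
  have g: "g a \<in> arcs H \<and> tail H (g a) = f (tail G a) \<and> head H (g a) = f (head G a)"
    if a: "a \<in> arcs G" for a
  proof -
    have "f (tail G a) \<rightarrow>\<^bsub>H\<^esub> f (head G a)"
      using a adj[of "tail G a" "head G a"] by (auto simp: arcs_ends_conv)
    then have im: "(f (tail G a), f (head G a)) \<in> arc_to_ends H ` arcs H"
      by (simp add: arcs_ends_def)
    have "arc_to_ends H (g a) = (f (tail G a), f (head G a))"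
      unfolding g_def by (rule f_the_inv_into_f[OF inj im])
    moreover have "g a \<in> arcs H"
      unfolding g_def by (rule the_inv_into_into[OF inj im order_refl])
    ultimately show ?thesis by (simp add: arc_to_ends_def)
  qed
  have finj: "inj_on f (verts G)" and fim: "f ` verts G = verts H"
    using bij by (auto simp: bij_betw_def)
  have ginj: "inj_on g (arcs G)"
  proof (rule inj_onI)
    fix a b assume ab: "a \<in> arcs G" "b \<in> arcs G" "g a = g b"
    then have "f (tail G a) = f (tail G b)" "f (head G a) = f (head G b)"
      using g by metis+
    then have "tail G a = tail G b" "head G a = head G b"
      using finj ab by (auto dest: inj_onD)
    then show "a = b"
      using ab by (intro G.no_multi_arcs) (auto simp: arc_to_ends_def)
  qed
  have gim: "g ` arcs G = arcs H"
  proof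
    show "g ` arcs G \<subseteq> arcs H" using g by auto
    show "arcs H \<subseteq> g ` arcs G"
    proof
      fix b assume b: "b \<in> arcs H"
      then obtain u v where uv: "u \<in> verts G" "v \<in> verts G" "f u = tail H b" "f v = head H b"
        using fim H.wellformed by (metis imageE)
      then have "u \<rightarrow>\<^bsub>G\<^esub> v"
        using adj b by (auto simp: arcs_ends_conv)
      then obtain a where a: "a \<in> arcs G" "tail G a = u" "head G a = v"
        by (auto simp: arcs_ends_conv)
      have "g a = b"
        using a b uv g[OF a(1)] by (intro H.no_multi_arcs) (auto simp: arc_to_ends_def)
      with a show "b \<in> g ` arcs G" by blast
    qed
  qed
  let ?h = "\<lparr>iso_verts = f, iso_arcs = g, iso_head = head H, iso_tail = tail H\<rparr>"
  have "pre_digraph.digraph_isomorphism G ?h"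
    unfolding pre_digraph.digraph_isomorphism_def
    using finj ginj g G.wf_digraph_axioms by simp
  moreover have "H = app_iso ?h G"
    by (simp add: app_iso_def fim gim)
  ultimately show ?thesis
    unfolding digraph_iso_def by blast
qed

section \<open>Making a graph the set of minimum-degree vertices\<close>

text \<open>
  The vertices from \<open>n\<close> on are the clique. Joining \<open>i < n\<close> to its first \<open>n - deg i\<close> vertices,
  that is, to those below \<open>2 * n - deg i\<close>, raises the degree of \<open>i\<close> to \<open>n\<close>.
\<close>

definition clique_padding :: "nat \<Rightarrow> (nat \<Rightarrow> nat \<Rightarrow> bool) \<Rightarrow> nat \<Rightarrow> nat \<Rightarrow> bool" where
  "clique_padding n r i j =
    (if i < n \<and> j < n then r i j
     else if i < n then j < 2 * n - card {k. k < n \<and> r k i}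
     else if j < n then i < 2 * n - card {k. k < n \<and> r k j}
     else i \<noteq> j)"

text \<open>
  With \<open>n + 2\<close> clique vertices, each of them has clique neighbours enough to exceed degree \<open>n\<close>.
\<close>

definition padded_graph :: "nat \<Rightarrow> (nat \<Rightarrow> nat \<Rightarrow> bool) \<Rightarrow> (nat, nat \<times> nat) pre_digraph" where
  "padded_graph n r = relation_graph {..<2 * n + 2} (clique_padding n r)"

lemma verts_padded_graph [simp]: "verts (padded_graph n r) = {..<2 * n + 2}"
  by (simp add: padded_graph_def)

lemma dominates_padded_graph:
  "u \<rightarrow>\<^bsub>padded_graph n r\<^esub> v \<longleftrightarrow> u < 2 * n + 2 \<and> v < 2 * n + 2 \<and> clique_padding n r u v"
  by (simp add: padded_graph_def dominates_relation_graph)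

context
  fixes n :: nat and r :: "nat \<Rightarrow> nat \<Rightarrow> bool"
  assumes irrefl: "\<And>i. \<not> r i i" and sym: "\<And>i j. r i j \<Longrightarrow> r j i"
begin

lemma graph_padded_graph: "graph (padded_graph n r)"
  unfolding padded_graph_def
  by (rule graph_relation_graph) (auto simp: clique_padding_def irrefl sym split: if_splits)

lemma degree_less:
  assumes "i < n"
  shows "card {k. k < n \<and> r k i} < n"
proof -
  have "{k. k < n \<and> r k i} \<subset> {..<n}"
    using assms irrefl by auto
  from psubset_card_mono[OF _ this] show ?thesis by simp
qed

text \<open>
  Vertex \<open>n\<close> is the first vertex of the clique, and every \<open>i < n\<close> is joined to at least one clique
  vertex because its degree under \<open>r\<close> is less than \<open>n\<close>.
\<close>

lemma padded_graph_hub: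
  assumes "i < 2 * n + 2" "i \<noteq> n"
  shows "i \<rightarrow>\<^bsub>padded_graph n r\<^esub> n" "n \<rightarrow>\<^bsub>padded_graph n r\<^esub> i"
  using assms degree_less[of i] by (auto simp: dominates_padded_graph clique_padding_def)

lemma padded_graph_diameter_two:
  assumes "u \<in> verts (padded_graph n r)" "x \<in> verts (padded_graph n r)" "u \<noteq> x"
  shows "u \<rightarrow>\<^bsub>padded_graph n r\<^esub> x \<or>
    (\<exists>w. u \<rightarrow>\<^bsub>padded_graph n r\<^esub> w \<and> w \<rightarrow>\<^bsub>padded_graph n r\<^esub> x)"
proof (cases "u = n \<or> x = n")
  case True
  with assms padded_graph_hub show ?thesis by auto
next
  case False
  with assms padded_graph_hub(1)[of u] padded_graph_hub(2)[of x] show ?thesis by auto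
qed

lemma connected_padded_graph: "Digraph_Component.connected (padded_graph n r)"
proof -
  interpret graph "padded_graph n r" by (rule graph_padded_graph)
  have reach: "u \<rightarrow>\<^sup>*\<^bsub>padded_graph n r\<^esub> x"
    if "u \<in> verts (padded_graph n r)" "x \<in> verts (padded_graph n r)" for u x
  proof (cases "u = x")
    case True
    with that show ?thesis by (simp only: reachable_refl)
  next
    case False
    with that show ?thesis
      using padded_graph_diameter_two by (meson reachable_adjI reachable_trans)
  qed
  have "verts (padded_graph n r) \<noteq> {}" by (auto simp: lessThan_empty_iff)
  then show ?thesis
    by (rule connectedI) (intro reachable_mk_symmetricI reach)
qed

lemma padded_graph_degree:
  assumes "i < n"
  shows "card {u. u \<rightarrow>\<^bsub>padded_graph n r\<^esub> i} = n"
proof -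
  let ?d = "card {k. k < n \<and> r k i}"
  have "{u. u \<rightarrow>\<^bsub>padded_graph n r\<^esub> i} = {k. k < n \<and> r k i} \<union> {n..<2 * n - ?d}"
    using assms by (auto simp: dominates_padded_graph clique_padding_def)
  also have "card \<dots> = ?d + (2 * n - ?d - n)"
    by (subst card_Un_disjoint) auto
  also have "\<dots> = n"
    using degree_less[OF assms] by simp
  finally show ?thesis .
qed

lemma padded_graph_clique_degree:
  assumes "n \<le> c" "c < 2 * n + 2"
  shows "n < card {u. u \<rightarrow>\<^bsub>padded_graph n r\<^esub> c}"
proof -
  have "n < card ({n..<2 * n + 2} - {c})"
    using assms by simp
  also have "\<dots> \<le> card {u. u \<rightarrow>\<^bsub>padded_graph n r\<^esub> c}"
    using assms
    by (intro card_mono finite_subset[of "{u. u \<rightarrow>\<^bsub>padded_graph n r\<^esub> c}" "{..<2 * n + 2}"])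
      (auto simp: dominates_padded_graph clique_padding_def)
  finally show ?thesis .
qed

lemma harmonic_periphery_padded_graph:
  assumes "0 < n"
  shows "harmonic_periphery (padded_graph n r) = relation_graph {..<n} r"
proof -
  let ?F = "padded_graph n r"
  interpret graph ?F by (rule graph_padded_graph)
  have min: "(\<forall>y \<in> verts ?F. card {u. u \<rightarrow>\<^bsub>?F\<^esub> x} \<le> card {u. u \<rightarrow>\<^bsub>?F\<^esub> y}) \<longleftrightarrow> x < n"
    if x: "x \<in> verts ?F" for x
  proof
    assume "\<forall>y \<in> verts ?F. card {u. u \<rightarrow>\<^bsub>?F\<^esub> x} \<le> card {u. u \<rightarrow>\<^bsub>?F\<^esub> y}"
    then have "card {u. u \<rightarrow>\<^bsub>?F\<^esub> x} \<le> card {u. u \<rightarrow>\<^bsub>?F\<^esub> 0}"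
      by (rule bspec) simp
    then have le: "card {u. u \<rightarrow>\<^bsub>?F\<^esub> x} \<le> n"
      by (simp only: padded_graph_degree[OF assms])
    show "x < n"
    proof (rule ccontr)
      assume "\<not> x < n"
      then have "n < card {u. u \<rightarrow>\<^bsub>?F\<^esub> x}"
        using x by (intro padded_graph_clique_degree) auto
      with le show False by simp
    qed
  next
    assume "x < n"
    then have "card {u. u \<rightarrow>\<^bsub>?F\<^esub> x} = n"
      by (rule padded_graph_degree)
    moreover have "n \<le> card {u. u \<rightarrow>\<^bsub>?F\<^esub> y}" if "y \<in> verts ?F" for y
      using that padded_graph_degree[of y] padded_graph_clique_degree[of y]
      by (cases "y < n") auto
    ultimately show "\<forall>y \<in> verts ?F. card {u. u \<rightarrow>\<^bsub>?F\<^esub> x} \<le> card {u. u \<rightarrow>\<^bsub>?F\<^esub> y}"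
      by simp
  qed
  have "harmonic_periphery ?F = ?F \<restriction>
      {x \<in> verts ?F. \<forall>y \<in> verts ?F. card {u. u \<rightarrow>\<^bsub>?F\<^esub> x} \<le> card {u. u \<rightarrow>\<^bsub>?F\<^esub> y}}"
    by (rule diameter_two_harmonic_periphery[OF padded_graph_diameter_two])
  also have "{x \<in> verts ?F. \<forall>y \<in> verts ?F. card {u. u \<rightarrow>\<^bsub>?F\<^esub> x} \<le> card {u. u \<rightarrow>\<^bsub>?F\<^esub> y}}
      = {x \<in> verts ?F. x < n}"
    using min by blast
  also have "{x \<in> verts ?F. x < n} = {..<n}" by auto
  also have "?F \<restriction> {..<n} = relation_graph {..<n} (clique_padding n r)"
    unfolding padded_graph_def by (rule induce_relation_graph) auto
  also have "\<dots> = relation_graph {..<n} r"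
    by (auto simp: relation_graph_def clique_padding_def)
  finally show ?thesis .
qed

end

theorem theorem2:
  fixes G :: "('a, 'b) pre_digraph" and n :: nat
  assumes "n \<ge> 1"
    and "graph G"
    and "Digraph_Component.connected G"
    and "card (verts G) = n"
  shows "\<exists>F :: (nat, nat \<times> nat) pre_digraph.
           graph F \<and> Digraph_Component.connected F \<and>
           card (verts F) \<le> 2 * n ^ 2 + 3 * n + 4 \<and>
           digraph_iso (harmonic_periphery F) G"
proof -
  interpret G: graph G by fact
  obtain f where f: "bij_betw f {..<n} (verts G)"
    using ex_bij_betw_nat_finite[OF G.finite_verts] assms(4) by (auto simp: atLeast0LessThan)
  define r where "r i j \<longleftrightarrow> f i \<rightarrow>\<^bsub>G\<^esub> f j" for i j
  have irrefl: "\<not> r i i" for i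
  proof
    assume "r i i"
    then obtain e where "e \<in> arcs G" "tail G e = head G e"
      unfolding r_def arcs_ends_conv by force
    then show False
      using G.no_loops by blast
  qed
  have sym: "r j i" if "r i j" for i j
    using that unfolding r_def by (rule G.graph_symmetric)
  have "graph (relation_graph {..<n} r)"
    by (rule graph_relation_graph) (auto simp: irrefl sym)
  then have "digraph_iso (relation_graph {..<n} r) G"
    using f by (intro digraph_iso_if_dominates_iff[where f = f])
      (auto simp: r_def dominates_relation_graph intro: graph.axioms digraph.axioms G.nomulti_digraph)
  then have "digraph_iso (harmonic_periphery (padded_graph n r)) G"
    using assms(1) by (simp add: harmonic_periphery_padded_graph[where r = r, OF irrefl sym])
  moreover have "card (verts (padded_graph n r)) \<le> 2 * n ^ 2 + 3 * n + 4"
    by simp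
  ultimately show ?thesis
    using graph_padded_graph[where r = r, OF irrefl sym] connected_padded_graph[where r = r, OF irrefl sym] by blast
qed

end
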